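(* Let $\sigma:A\to A^+$ be a primitive substitution whose matrix $M$ has strictly positive entries, let $\theta_1$ be the Perron-Frobenius eigenvalue of $M$, and let $\theta_2$ be an eigenvalue of $M$ that is a Galois conjugate of $\theta_1$ over $\mathbb{Q}$, is real, and satisfies $1<\theta_2<\theta_1$. Let $\gamma$ be the eigenvector of $M$ for $\theta_2$ defined in the context. Let $x\in X_\sigma$ be a minimal point. Then $$\liminf_{n\to\infty}\frac{\gamma(x_0\ldots x_n)}{n^{\log(\theta_2)/\log(\theta_1)}}>0\quad\text{and}\quad\liminf_{n\to\infty}\frac{-\gamma(x_{-n}\ldots x_{-1})}{n^{\log(\theta_2)/\log(\theta_1)}}>0.$$
   Context: $A$ is a finite alphabet, $A^+$ the set of nonempty finite words. A substitution $\sigma:A\to A^+$ extends to words by concatenation. Its matrix is $M=(M_{ab})_{a,b\in A}$, $M_{ab}$ = number of occurrences of $b$ in $\sigma(a)$. $\sigma$ is primitive if for some $N$ every $\sigma^N(a)$ contains every letter. $X_\sigma\subseteq A^{\mathbb{Z}}$ is the set of two-sided sequences $x$ all of whose finite subwords are subwords of some $\sigma^N(a)$, $N\in\mathbb{N}$, $a\in A$. Let $\lambda=(\lambda(a))_{a\in A}$ be a strictly positive right eigenvector of $M$ for $\theta_1$, normalized so that its coordinates lie in $\mathbb{Q}[\theta_1]$; let $\eta:\mathbb{Q}[\theta_1]\to\mathbb{Q}[\theta_2]$ be the field homomorphism with $\eta(\theta_1)=\theta_2$, and $\gamma(a)=\eta(\lambda(a))$; then $M\gamma=\theta_2\gamma$.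 For a word $w=w_0\ldots w_{l-1}$, $\gamma(w)=\gamma(w_0)+\dots+\gamma(w_{l-1})$. For $x\in X_\sigma$ put $\gamma_0(x)=0$, $\gamma_n(x)=\sum_{i=0}^{n-1}\gamma(x_i)$ for $n>0$, and $\gamma_n(x)=-\sum_{i=n}^{-1}\gamma(x_i)$ for $n<0$. The point $x$ is minimal if $\gamma_n(x)\ge0$ for all $n\in\mathbb{Z}$. *)

theory Defs
  imports
    "HOL-Analysis.Analysis"
    "HOL-Computational_Algebra.Computational_Algebra"
    "HOL-Library.Sublist"
begin

text \<open>The alphabet is a finite type. A substitution is its action on letters; its values are
  required to be nonempty by \<^term>\<open>substitution\<close> below.\<close>

definition subst_word :: "('a \<Rightarrow> 'a list) \<Rightarrow> 'a list \<Rightarrow> 'a list" where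
  "subst_word \<sigma> w = concat (map \<sigma> w)"

definition substitution :: "('a \<Rightarrow> 'a list) \<Rightarrow> bool" where
  "substitution \<sigma> \<longleftrightarrow> (\<forall>a. \<sigma> a \<noteq> [])"

definition subst_primitive :: "('a \<Rightarrow> 'a list) \<Rightarrow> bool" where
  "subst_primitive \<sigma> \<longleftrightarrow> (\<exists>N. \<forall>a b. b \<in> set ((subst_word \<sigma> ^^ N) [a]))"

definition subst_matrix :: "('a::finite \<Rightarrow> 'a list) \<Rightarrow> real ^ 'a ^ 'a" where
  "subst_matrix \<sigma> = (\<chi> a b. real (count_list (\<sigma> a) b))"

text \<open>The finite subwords of a two-sided sequence \<open>x\<close> are the words \<open>map x [i..j]\<close>
  (empty if \<open>j < i\<close>); \<^const>\<open>sublist\<close> is the contiguous-subword relation.\<close>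

definition subst_shift :: "('a \<Rightarrow> 'a list) \<Rightarrow> (int \<Rightarrow> 'a) set" where
  "subst_shift \<sigma> = {x. \<forall>i j. \<exists>N a. sublist (map x [i..j]) ((subst_word \<sigma> ^^ N) [a])}"

definition eigenvector :: "'f::field ^ 'n ^ 'n \<Rightarrow> 'f ^ 'n \<Rightarrow> 'f \<Rightarrow> bool" where
  "eigenvector M v \<theta> \<longleftrightarrow> v \<noteq> 0 \<and> M *v v = \<theta> *s v"

definition eigenvalue :: "'f::field ^ 'n ^ 'n \<Rightarrow> 'f \<Rightarrow> bool" where
  "eigenvalue M \<theta> \<longleftrightarrow> (\<exists>v. eigenvector M v \<theta>)"

text \<open>The positive eigenvalue that strictly dominates all other complex eigenvalues in modulus.\<close>

definition perron_frobenius_eigenvalue :: "real ^ 'n ^ 'n \<Rightarrow> real \<Rightarrow> bool" where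
  "perron_frobenius_eigenvalue M \<theta> \<longleftrightarrow>
     0 < \<theta> \<and> eigenvalue M \<theta> \<and>
     (\<forall>z. eigenvalue (map_matrix complex_of_real M) z \<and> z \<noteq> complex_of_real \<theta> \<longrightarrow> cmod z < \<theta>)"

definition galois_conjugate :: "real \<Rightarrow> real \<Rightarrow> bool" where
  "galois_conjugate \<alpha> \<beta> \<longleftrightarrow>
     (\<exists>p::rat poly. irreducible p \<and>
        poly (map_poly of_rat p) \<alpha> = 0 \<and> poly (map_poly of_rat p) \<beta> = 0)"

text \<open>The ring generated by \<open>\<alpha>\<close> over the rationals, which is a field when \<open>\<alpha>\<close> is algebraic.\<close>

definition rat_adjoin :: "real \<Rightarrow> real set" where
  "rat_adjoin \<alpha> = range (\<lambda>p::rat poly. poly (map_poly of_rat p) \<alpha>)"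

text \<open>Homomorphisms of unital rings between subrings of the reals; values of \<open>\<eta>\<close> outside
  \<open>K\<close> are irrelevant.\<close>

definition field_hom_on :: "real set \<Rightarrow> real set \<Rightarrow> (real \<Rightarrow> real) \<Rightarrow> bool" where
  "field_hom_on K L \<eta> \<longleftrightarrow>
     \<eta> ` K \<subseteq> L \<and> \<eta> 1 = 1 \<and>
     (\<forall>u\<in>K. \<forall>v\<in>K. \<eta> (u + v) = \<eta> u + \<eta> v \<and> \<eta> (u * v) = \<eta> u * \<eta> v)"

definition word_weight :: "real ^ 'a \<Rightarrow> 'a list \<Rightarrow> real" where
  "word_weight \<gamma> w = (\<Sum>a\<leftarrow>w. \<gamma> $ a)"

definition partial_weight :: "real ^ 'a \<Rightarrow> (int \<Rightarrow> 'a) \<Rightarrow> int \<Rightarrow> real" where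
  "partial_weight \<gamma> x n =
     (if 0 \<le> n then (\<Sum>i\<in>{0..<n}. \<gamma> $ x i) else - (\<Sum>i\<in>{n..-1}. \<gamma> $ x i))"

definition minimal_point :: "('a \<Rightarrow> 'a list) \<Rightarrow> real ^ 'a \<Rightarrow> (int \<Rightarrow> 'a) \<Rightarrow> bool" where
  "minimal_point \<sigma> \<gamma> x \<longleftrightarrow> x \<in> subst_shift \<sigma> \<and> (\<forall>n. 0 \<le> partial_weight \<gamma> x n)"

end

theory Submission
  imports Defs "HOL-Computational_Algebra.Field_as_Ring"
begin

text \<open>Write \<open>\<alpha> = ln \<theta>\<^sub>2 / ln \<theta>\<^sub>1\<close>. Applying \<open>\<sigma>\<^sup>q\<close> multiplies lengths by about \<open>\<theta>\<^sub>1\<^sup>q\<close> and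
  \<open>\<gamma>\<close>-weights by exactly \<open>\<theta>\<^sub>2\<^sup>q = (\<theta>\<^sub>1\<^sup>q)\<^sup>\<alpha>\<close>, so a weight of order \<open>n\<^sup>\<alpha>\<close> over a distance \<open>n\<close> is a
  statement that is invariant under rescaling, and the task is to find a gap of constant size at
  every scale.

  A window of \<open>x\<close> around the origin occurs in some \<open>\<sigma>\<^sup>N(a)\<close>; there the origin and the position
  at distance \<open>n\<close> are two cuts. Going down the levels of \<open>\<sigma>\<^sup>N(a)\<close>, stop as soon as the blocks
  \<open>\<sigma>\<^sup>q(c)\<close> and \<open>\<sigma>\<^sup>q(d)\<close> that contain the cuts are neither equal nor adjacent
  (\<open>separated_blocks\<close>). They are then separated by \<open>\<sigma>\<^sup>q(v)\<close> with \<open>v\<close> nonempty and of bounded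
  length, whence \<open>n = O(\<theta>\<^sub>1\<^sup>q)\<close>. Let \<open>m\<^sub>q(c)\<close> be the minimal weight of a proper prefix of
  \<open>\<sigma>\<^sup>q(c)\<close>, divided by \<open>\<theta>\<^sub>2\<^sup>q\<close>. Since the origin minimizes the partial weights, it sits at the
  minimum of its block, and the weight between the two cuts is in modulus at least \<open>\<theta>\<^sub>2\<^sup>q\<close> times
  that of the gap \<open>\<gamma>(cv) + m\<^sub>q(d) - m\<^sub>q(c)\<close> (\<open>gap_at_minimizer\<close>).

  The \<open>m\<^sub>q\<close> decrease to a limit \<open>m\<close>, and only finitely many triples \<open>(c, v, d)\<close> occur, so it
  remains to see that no limit gap \<open>\<gamma>(cv) + m(d) - m(c)\<close> vanishes (\<open>limit_gap_nonzero\<close>). This is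
  where the conjugate eigenvector enters. The minimum \<open>m(c)\<close> is reached at a point of the infinitely
  refined block \<open>c\<close> whose address is eventually periodic, so \<open>m(c)\<close> lies in \<open>\<rat>(\<theta>\<^sub>2)\<close> and is the
  conjugate of the position \<open>\<nu>(c)\<close> of the same point measured by \<open>\<lambda>\<close>. A vanishing gap would
  conjugate to \<open>\<lambda>(cv) + \<nu>(d) - \<nu>(c) = 0\<close>, which is impossible because \<open>0 \<le> \<nu>(d)\<close>,
  \<open>\<nu>(c) \<le> \<lambda>(c)\<close> and \<open>0 < \<lambda>(v)\<close>. Nonemptiness of \<open>v\<close> matters: for adjacent blocks the minimum of
  \<open>c\<close> may lie at its right end and that of \<open>d\<close> at its left end.\<close>

section \<open>Weights and blocks of iterated images\<close>

lemma word_weight_simps [simp]: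
  "word_weight \<gamma> [] = 0"
  "word_weight \<gamma> (a # w) = \<gamma> $ a + word_weight \<gamma> w"
  "word_weight \<gamma> (u @ v) = word_weight \<gamma> u + word_weight \<gamma> v"
  by (simp_all add: word_weight_def)

lemma funpow_subst_word_append [simp]:
  "(subst_word \<sigma> ^^ q) (u @ v) = (subst_word \<sigma> ^^ q) u @ (subst_word \<sigma> ^^ q) v"
  by (induction q) (simp_all add: subst_word_def)

lemma funpow_subst_word_Nil [simp]: "(subst_word \<sigma> ^^ q) [] = []"
  by (induction q) (simp_all add: subst_word_def)

lemma funpow_subst_word_Suc:
  "(subst_word \<sigma> ^^ Suc q) w = (subst_word \<sigma> ^^ q) (subst_word \<sigma> w)"
  by (simp add: funpow_swap1)

lemma subst_word_singleton [simp]: "subst_word \<sigma> [a] = \<sigma> a"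
  by (simp add: subst_word_def)

lemma length_subst_word_le:
  assumes "\<And>a. length (\<sigma> a) \<le> L"
  shows "length (subst_word \<sigma> w) \<le> L * length w"
proof (induction w)
  case (Cons a w)
  then show ?case using assms[of a] by (simp add: subst_word_def)
qed (simp add: subst_word_def)

lemma subst_word_nonempty:
  assumes "substitution \<sigma>" "w \<noteq> []"
  shows "subst_word \<sigma> w \<noteq> []"
  using assms by (cases w) (auto simp: subst_word_def substitution_def)

lemma funpow_subst_word_nonempty:
  assumes "substitution \<sigma>" "w \<noteq> []"
  shows "(subst_word \<sigma> ^^ q) w \<noteq> []"
  by (induction q) (use assms in \<open>simp_all add: subst_word_nonempty\<close>)

lemma word_weight_subst_word:
  assumes "\<And>a. word_weight \<gamma> (\<sigma> a) = \<theta> * \<gamma> $ a"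
  shows "word_weight \<gamma> (subst_word \<sigma> w) = \<theta> * word_weight \<gamma> w"
  using assms by (induction w) (simp_all add: subst_word_def algebra_simps)

lemma word_weight_funpow:
  assumes "\<And>a. word_weight \<gamma> (\<sigma> a) = \<theta> * \<gamma> $ a"
  shows "word_weight \<gamma> ((subst_word \<sigma> ^^ q) w) = \<theta> ^ q * word_weight \<gamma> w"
  by (induction q) (simp_all add: word_weight_subst_word[OF assms])

text \<open>A position inside the word \<open>\<sigma>\<^sup>q(u)\<close> is attributed to the letter of \<open>u\<close> whose image covers it;
  positions are numbers of letters to the left, so the left end of a block belongs to it and the right
  end does not.\<close>

lemma block_containing:
  assumes "s < length ((subst_word \<sigma> ^^ q) u)"
  shows "\<exists>u1 c u2. u = u1 @ c # u2 \<and> length ((subst_word \<sigma> ^^ q) u1) \<le> s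
    \<and> s < length ((subst_word \<sigma> ^^ q) (u1 @ [c]))"
  using assms
proof (induction u rule: rev_induct)
  case (snoc c u)
  show ?case
  proof (cases "s < length ((subst_word \<sigma> ^^ q) u)")
    case True
    then obtain u1 c' u2 where "u = u1 @ c' # u2" "length ((subst_word \<sigma> ^^ q) u1) \<le> s"
      "s < length ((subst_word \<sigma> ^^ q) (u1 @ [c']))"
      using snoc.IH by blast
    then show ?thesis
      by (intro exI[of _ u1] exI[of _ c'] exI[of _ "u2 @ [c]"]) simp
  next
    case False
    then show ?thesis
      using snoc.prems by (intro exI[of _ u] exI[of _ c] exI[of _ "[]"]) simp
  qed
qed simp

text \<open>Induction on the number of levels. As long as both cuts lie in the image of one or two consecutive
  letters, these are expanded once and the induction hypothesis applies; otherwise at least one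
  letter separates the two blocks, and \<open>v\<close> is short because it is part of \<open>\<sigma>(u)\<close> with \<open>u\<close> of
  length at most two. The process must stop with separated blocks since at level \<open>0\<close> cuts at distance
  two or more do not fit into a word of length two.\<close>

lemma separated_blocks:
  assumes L: "\<And>a. length (\<sigma> a) \<le> L"
  assumes "length u \<le> 2" "s + 2 \<le> t" "t < length ((subst_word \<sigma> ^^ p) u)"
  shows "\<exists>q c v d Y Z. (subst_word \<sigma> ^^ p) u = Y @ (subst_word \<sigma> ^^ q) (c # v @ [d]) @ Z
    \<and> v \<noteq> [] \<and> length v \<le> 2 * L
    \<and> length Y \<le> s \<and> s < length (Y @ (subst_word \<sigma> ^^ q) [c])
    \<and> length (Y @ (subst_word \<sigma> ^^ q) (c # v)) \<le> t
    \<and> t < length (Y @ (subst_word \<sigma> ^^ q) (c # v @ [d]))"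
  using assms(2-)
proof (induction p arbitrary: u s t)
  case 0
  then show ?case by simp
next
  case (Suc p)
  define S where "S = (subst_word \<sigma> ^^ p)"
  have app: "S (x @ y) = S x @ S y" for x y by (simp add: S_def)
  have Cons: "S (c # y) = S [c] @ S y" for c y using app[of "[c]" y] by simp
  define u' where "u' = subst_word \<sigma> u"
  have eq: "(subst_word \<sigma> ^^ Suc p) u = S u'"
    by (simp only: u'_def S_def funpow_subst_word_Suc)
  have "length u' \<le> L * length u"
    unfolding u'_def by (rule length_subst_word_le[OF L])
  also have "\<dots> \<le> L * 2" using Suc.prems(1) by simp
  finally have len: "length u' \<le> 2 * L" by simp
  have t: "t < length (S u')" using Suc.prems(3) eq by simp
  have short: ?case
    if that': "u' = y @ w @ z" "length w \<le> 2" "length (S y) \<le> s" "t < length (S (y @ w))" for y w z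
  proof -
    have "s - length (S y) + 2 \<le> t - length (S y)"
      using that' Suc.prems(2) by linarith
    moreover have "t - length (S y) < length ((subst_word \<sigma> ^^ p) w)"
      using that' Suc.prems(2) unfolding app S_def[symmetric] by simp
    ultimately obtain q c v d Y Z where *:
      "(subst_word \<sigma> ^^ p) w = Y @ (subst_word \<sigma> ^^ q) (c # v @ [d]) @ Z"
      "v \<noteq> []" "length v \<le> 2 * L" "length Y \<le> s - length (S y)"
      "s - length (S y) < length (Y @ (subst_word \<sigma> ^^ q) [c])"
      "length (Y @ (subst_word \<sigma> ^^ q) (c # v)) \<le> t - length (S y)"
      "t - length (S y) < length (Y @ (subst_word \<sigma> ^^ q) (c # v @ [d]))"
      using Suc.IH[OF that'(2)] by blast
    show ?thesis
    proof (intro exI conjI)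
      show "(subst_word \<sigma> ^^ Suc p) u
          = (S y @ Y) @ (subst_word \<sigma> ^^ q) (c # v @ [d]) @ (Z @ S z)"
        unfolding eq that'(1) app using *(1) by (simp add: S_def)
    qed (use * that' Suc.prems(2) in \<open>auto simp del: funpow_subst_word_append\<close>)
  qed
  have "s < length (S u')" using t Suc.prems(2) by simp
  then obtain u1 c u2 where c: "u' = u1 @ c # u2" "length (S u1) \<le> s" "s < length (S (u1 @ [c]))"
    using block_containing[of s p \<sigma> u'] unfolding S_def by blast
  show ?case
  proof (cases "t < length (S (u1 @ [c]))")
    case True
    then show ?thesis using short[of u1 "[c]" u2] c by simp
  next
    case False
    then have "t - length (S (u1 @ [c])) < length (S u2)"
      using t c(1) app[of "u1 @ [c]" u2] by simp
    then obtain v d u3 where d: "u2 = v @ d # u3" "length (S v) \<le> t - length (S (u1 @ [c]))"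
      "t - length (S (u1 @ [c])) < length (S (v @ [d]))"
      using block_containing[of "t - length (S (u1 @ [c]))" p \<sigma> u2] unfolding S_def by blast
    show ?thesis
    proof (cases "v = []")
      case True
      have "t < length (S (u1 @ [c, d]))"
        using d(3) False True app[of "u1 @ [c]" "[d]"] by simp
      then show ?thesis using short[of u1 "[c, d]" u3] c d True by simp
    next
      case v: False
      have "length v \<le> 2 * L" using len unfolding c(1) d(1) by simp
      moreover have "length (S u1 @ S (c # v)) \<le> t" "t < length (S u1 @ S (c # v @ [d]))"
          "s < length (S u1 @ S [c])"
        using d(2,3) False c(3) unfolding app Cons[of c "v @ [d]"] Cons[of c v] by auto
      moreover have "(subst_word \<sigma> ^^ Suc p) u = S u1 @ S (c # v @ [d]) @ S u3"
        unfolding eq c(1) d(1) by (simp flip: app)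
      ultimately show ?thesis
        using v c(2) unfolding S_def by blast
    qed
  qed
qed

section \<open>Minimal prefixes\<close>

text \<open>Only proper prefixes are admitted: they are the cuts that \<open>block_containing\<close> attributes to the
  block, and each of them is followed by a letter that can be refined further.\<close>

definition min_prefix_weight :: "real ^ 'a \<Rightarrow> 'a list \<Rightarrow> real" where
  "min_prefix_weight \<gamma> w = Min ((\<lambda>k. word_weight \<gamma> (take k w)) ` {..<length w})"

lemma min_prefix_weight_le:
  "k < length w \<Longrightarrow> min_prefix_weight \<gamma> w \<le> word_weight \<gamma> (take k w)"
  unfolding min_prefix_weight_def by (intro Min_le) auto

lemma min_prefix_weight_attained:
  assumes "w \<noteq> []"
  obtains k where "k < length w" "min_prefix_weight \<gamma> w = word_weight \<gamma> (take k w)"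
proof -
  have "min_prefix_weight \<gamma> w \<in> (\<lambda>k. word_weight \<gamma> (take k w)) ` {..<length w}"
    unfolding min_prefix_weight_def by (intro Min_in) (use assms in auto)
  then show ?thesis using that by auto
qed

text \<open>Stands for the minimality of the origin, seen through a finite window of radius \<open>r\<close>.\<close>

definition minimal_prefix_within :: "real ^ 'a \<Rightarrow> 'a list \<Rightarrow> real \<Rightarrow> nat \<Rightarrow> bool" where
  "minimal_prefix_within \<gamma> W r p \<longleftrightarrow> (\<forall>k < length W. \<bar>real k - real p\<bar> \<le> r \<longrightarrow>
     word_weight \<gamma> (take p W) \<le> word_weight \<gamma> (take k W))"

locale expanding_weight =
  fixes \<sigma> :: "'a::finite \<Rightarrow> 'a list" and \<gamma> :: "real ^ 'a" and \<theta> :: real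
  assumes substitution: "substitution \<sigma>"
    and expanding: "1 < \<theta>"
    and weight_image: "\<And>a. word_weight \<gamma> (\<sigma> a) = \<theta> * \<gamma> $ a"
begin

abbreviation iterate :: "nat \<Rightarrow> 'a list \<Rightarrow> 'a list" where
  "iterate q \<equiv> subst_word \<sigma> ^^ q"

lemma weight_iterate: "word_weight \<gamma> (iterate q w) = \<theta> ^ q * word_weight \<gamma> w"
  by (rule word_weight_funpow[OF weight_image])

lemma iterate_nonempty: "w \<noteq> [] \<Longrightarrow> iterate q w \<noteq> []"
  by (rule funpow_subst_word_nonempty[OF substitution])

definition scaled_min :: "nat \<Rightarrow> 'a \<Rightarrow> real" where
  "scaled_min q a = min_prefix_weight \<gamma> (iterate q [a]) / \<theta> ^ q"

lemma scaled_min_mult: "\<theta> ^ q * scaled_min q a = min_prefix_weight \<gamma> (iterate q [a])"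
  using expanding by (simp add: scaled_min_def)

text \<open>A proper prefix of \<open>\<sigma>\<^sup>q\<^sup>+\<^sup>1(a) = \<sigma>\<^sup>q(\<sigma>(a))\<close> consists of the images of some letters of \<open>\<sigma>(a)\<close> and a
  proper prefix of the image of the next one, so minimizing decouples into a choice at the first level
  and a minimum one level lower.\<close>

lemma scaled_min_Suc:
  "\<exists>u b s. \<sigma> a = u @ b # s \<and> \<theta> * scaled_min (Suc q) a = word_weight \<gamma> u + scaled_min q b"
proof -
  have it: "iterate (Suc q) [a] = iterate q (\<sigma> a)"
    by (simp only: funpow_subst_word_Suc subst_word_singleton)
  obtain k where k: "k < length (iterate q (\<sigma> a))"
    "min_prefix_weight \<gamma> (iterate q (\<sigma> a)) = word_weight \<gamma> (take k (iterate q (\<sigma> a)))"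
    using min_prefix_weight_attained[of "iterate (Suc q) [a]"] iterate_nonempty[of "[a]" "Suc q"]
    unfolding it by (metis list.distinct(1))
  obtain u b s where u: "\<sigma> a = u @ b # s" "length (iterate q u) \<le> k"
    "k < length (iterate q (u @ [b]))"
    using block_containing[OF k(1)] by blast
  have split: "iterate q (\<sigma> a) = iterate q u @ iterate q [b] @ iterate q s"
    unfolding u(1) using funpow_subst_word_append[of q \<sigma> u "[b] @ s"]
      funpow_subst_word_append[of q \<sigma> "[b]" s] by simp
  have "min_prefix_weight \<gamma> (iterate q (\<sigma> a))
      = word_weight \<gamma> (iterate q u) + min_prefix_weight \<gamma> (iterate q [b])"
  proof (rule antisym)
    obtain l where l: "l < length (iterate q [b])"
      "min_prefix_weight \<gamma> (iterate q [b]) = word_weight \<gamma> (take l (iterate q [b]))"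
      using min_prefix_weight_attained[of "iterate q [b]"] iterate_nonempty[of "[b]" q]
      by (metis list.distinct(1))
    have "min_prefix_weight \<gamma> (iterate q (\<sigma> a))
        \<le> word_weight \<gamma> (take (length (iterate q u) + l) (iterate q (\<sigma> a)))"
      by (rule min_prefix_weight_le) (use l in \<open>simp add: split\<close>)
    then show "min_prefix_weight \<gamma> (iterate q (\<sigma> a))
        \<le> word_weight \<gamma> (iterate q u) + min_prefix_weight \<gamma> (iterate q [b])"
      using l by (simp add: split)
  next
    have "min_prefix_weight \<gamma> (iterate q [b])
        \<le> word_weight \<gamma> (take (k - length (iterate q u)) (iterate q [b]))"
      by (rule min_prefix_weight_le) (use u in simp)
    then show "word_weight \<gamma> (iterate q u) + min_prefix_weight \<gamma> (iterate q [b])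
        \<le> min_prefix_weight \<gamma> (iterate q (\<sigma> a))"
      using u(2,3) split unfolding k(2) by simp
  qed
  then have "\<theta> ^ Suc q * scaled_min (Suc q) a
      = \<theta> ^ q * (word_weight \<gamma> u + scaled_min q b)"
    unfolding scaled_min_mult it weight_iterate distrib_left by simp
  then have "\<theta> * scaled_min (Suc q) a = word_weight \<gamma> u + scaled_min q b"
    using expanding by simp
  then show ?thesis using u(1) by blast
qed

text \<open>The image under \<open>\<sigma>\<close> of a minimal prefix competes at the next level, with the same scaled weight.\<close>

lemma decseq_scaled_min: "decseq (\<lambda>q. scaled_min q a)"
proof (rule decseq_SucI)
  fix q
  obtain k where k: "k < length (iterate q [a])"
    "min_prefix_weight \<gamma> (iterate q [a]) = word_weight \<gamma> (take k (iterate q [a]))"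
    using min_prefix_weight_attained[of "iterate q [a]"] iterate_nonempty[of "[a]" q]
    by (metis list.distinct(1))
  define P R where "P = take k (iterate q [a])" and "R = drop k (iterate q [a])"
  have PR: "iterate q [a] = P @ R" "R \<noteq> []" using k by (simp_all add: P_def R_def)
  then have it: "iterate (Suc q) [a] = subst_word \<sigma> P @ subst_word \<sigma> R"
    by (simp add: subst_word_def)
  have "min_prefix_weight \<gamma> (iterate (Suc q) [a])
      \<le> word_weight \<gamma> (take (length (subst_word \<sigma> P)) (iterate (Suc q) [a]))"
    by (rule min_prefix_weight_le)
      (unfold it, use subst_word_nonempty[OF substitution PR(2)] in simp)
  also have "\<dots> = \<theta> * min_prefix_weight \<gamma> (iterate q [a])"
    unfolding it k(2) P_def[symmetric] by (simp add: word_weight_subst_word[OF weight_image])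
  finally have "\<theta> ^ Suc q * scaled_min (Suc q) a \<le> \<theta> ^ Suc q * scaled_min q a"
    unfolding scaled_min_mult using scaled_min_mult[of q a] by (simp add: mult.assoc)
  then show "scaled_min (Suc q) a \<le> scaled_min q a"
    using expanding by simp
qed

text \<open>With \<open>G\<close> bounding the weights of all prefixes of all \<open>\<sigma>(a)\<close>, the recursion contracts by \<open>1 / \<theta>\<close> and
  gives the geometric bound \<open>- G (\<theta>\<^sup>-\<^sup>1 + \<theta>\<^sup>-\<^sup>2 + \<dots>) = - G / (\<theta> - 1)\<close>.\<close>

lemma scaled_min_bounded: "\<exists>B. \<forall>q a. B \<le> scaled_min q a"
proof -
  define weights where "weights = (\<lambda>a. \<Sum>b\<leftarrow>\<sigma> a. \<bar>\<gamma> $ b\<bar>)"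
  define G where "G = Max (range weights)"
  have G: "- G \<le> word_weight \<gamma> u" if "\<sigma> a = u @ b # s" for a u b s
  proof -
    have "- word_weight \<gamma> u \<le> (\<Sum>b\<leftarrow>u. \<bar>\<gamma> $ b\<bar>)"
      by (induction u) auto
    also have "\<dots> \<le> weights a"
      unfolding weights_def that by (auto intro!: add_nonneg_nonneg sum_list_nonneg)
    also have "\<dots> \<le> G" unfolding G_def by (intro Max_ge) auto
    finally show ?thesis by simp
  qed
  have "0 \<le> G"
  proof -
    have "0 \<le> weights undefined" unfolding weights_def by (intro sum_list_nonneg) auto
    also have "\<dots> \<le> G" unfolding G_def by (intro Max_ge) auto
    finally show ?thesis .
  qed
  have "- G / (\<theta> - 1) \<le> scaled_min q a" for q a
  proof (induction q arbitrary: a)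
    case 0
    have "scaled_min 0 a = 0"
      by (simp add: scaled_min_def min_prefix_weight_def lessThan_Suc)
    then show ?case using \<open>0 \<le> G\<close> expanding by simp
  next
    case (Suc q)
    obtain u b s where u: "\<sigma> a = u @ b # s"
      "\<theta> * scaled_min (Suc q) a = word_weight \<gamma> u + scaled_min q b"
      using scaled_min_Suc by blast
    have "\<theta> * (- G / (\<theta> - 1)) = - G + - G / (\<theta> - 1)"
      using expanding by (simp add: field_simps)
    also have "\<dots> \<le> \<theta> * scaled_min (Suc q) a"
      unfolding u(2) using G[OF u(1)] Suc.IH[of b] by linarith
    finally show ?case
      by (rule mult_left_le_imp_le) (use expanding in simp)
  qed
  then show ?thesis by blast
qed

definition limit_min :: "'a \<Rightarrow> real" where
  "limit_min a = lim (\<lambda>q. scaled_min q a)"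

lemma scaled_min_tendsto: "(\<lambda>q. scaled_min q a) \<longlonglongrightarrow> limit_min a"
proof -
  obtain B where "\<forall>q a. B \<le> scaled_min q a" using scaled_min_bounded by blast
  then obtain l where "(\<lambda>q. scaled_min q a) \<longlonglongrightarrow> l"
    using decseq_convergent[OF decseq_scaled_min] by metis
  then show ?thesis unfolding limit_min_def by (simp add: limI)
qed

text \<open>For each \<open>q\<close> some position in \<open>\<sigma>(a)\<close> is optimal. There are finitely many positions, hence one is
  optimal for infinitely many \<open>q\<close>, and the equation passes to the limit along those.\<close>

lemma limit_min_attained:
  "\<exists>u b s. \<sigma> a = u @ b # s \<and> \<theta> * limit_min a = word_weight \<gamma> u + limit_min b"
proof -
  define choice where "choice = (\<lambda>q k. k < length (\<sigma> a) \<and>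
    \<theta> * scaled_min (Suc q) a = word_weight \<gamma> (take k (\<sigma> a)) + scaled_min q (\<sigma> a ! k))"
  have "\<exists>k. choice q k" for q
  proof -
    obtain u b s where "\<sigma> a = u @ b # s"
      "\<theta> * scaled_min (Suc q) a = word_weight \<gamma> u + scaled_min q b"
      using scaled_min_Suc by blast
    then have "choice q (length u)" by (simp add: choice_def)
    then show ?thesis ..
  qed
  then have "\<exists>\<^sub>F q in sequentially. \<exists>k\<in>{..<length (\<sigma> a)}. choice q k"
    by (auto simp: choice_def intro!: eventually_frequently always_eventually)
  then obtain k where k: "\<exists>\<^sub>F q in sequentially. choice q k"
    by (subst (asm) frequently_bex_finite_distrib) auto
  define D where "D = (\<lambda>q. \<theta> * scaled_min (Suc q) a
    - (word_weight \<gamma> (take k (\<sigma> a)) + scaled_min q (\<sigma> a ! k)))"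
  define D' where "D' = \<theta> * limit_min a - (word_weight \<gamma> (take k (\<sigma> a)) + limit_min (\<sigma> a ! k))"
  have lim: "D \<longlonglongrightarrow> D'"
    unfolding D_def D'_def
    by (intro tendsto_intros scaled_min_tendsto LIMSEQ_Suc[OF scaled_min_tendsto])
  have "D' = 0"
  proof (rule ccontr)
    assume "D' \<noteq> 0"
    then have "\<forall>\<^sub>F q in sequentially. D q \<noteq> 0"
      using tendsto_imp_eventually_ne[OF lim] by simp
    moreover have "\<exists>\<^sub>F q in sequentially. D q = 0"
      using k by (rule frequently_elim1) (simp add: choice_def D_def)
    ultimately show False by (simp add: frequently_def)
  qed
  moreover have "k < length (\<sigma> a)"
    using frequently_ex[OF k] by (auto simp: choice_def)
  ultimately show ?thesis
    unfolding D'_def using id_take_nth_drop by fastforce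
qed

end

section \<open>Eventually periodic addresses\<close>

text \<open>Suppose that \<open>\<sigma>(a)\<close> is \<open>u(a)\<close> followed by the selected letter \<open>f(a)\<close> and some rest. Selecting
  repeatedly, \<open>j\<close> times, singles out one letter \<open>f\<^sup>j(a)\<close> in \<open>\<sigma>\<^sup>j(a)\<close>; the address is the word to
  the left of it.\<close>

primrec address :: "('a \<Rightarrow> 'a list) \<Rightarrow> ('a \<Rightarrow> 'a list) \<Rightarrow> ('a \<Rightarrow> 'a) \<Rightarrow> nat \<Rightarrow> 'a \<Rightarrow> 'a list" where
  "address \<sigma> u f 0 a = []"
| "address \<sigma> u f (Suc j) a = (subst_word \<sigma> ^^ j) (u a) @ address \<sigma> u f j (f a)"

lemma address_prefix:
  assumes "\<And>a. \<exists>s. \<sigma> a = u a @ f a # s"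
  shows "\<exists>s. (subst_word \<sigma> ^^ j) [a] = address \<sigma> u f j a @ (f ^^ j) a # s"
proof (induction j arbitrary: a)
  case (Suc j)
  obtain s where s: "\<sigma> a = u a @ [f a] @ s" using assms[of a] by auto
  obtain s' where s': "(subst_word \<sigma> ^^ j) [f a] = address \<sigma> u f j (f a) @ (f ^^ j) (f a) # s'"
    using Suc.IH by blast
  have "(subst_word \<sigma> ^^ Suc j) [a] = (subst_word \<sigma> ^^ j) (u a @ [f a] @ s)"
    by (simp only: funpow_subst_word_Suc subst_word_singleton s)
  also have "\<dots> = address \<sigma> u f (Suc j) a @ (f ^^ Suc j) a # s' @ (subst_word \<sigma> ^^ j) s"
    unfolding funpow_subst_word_append s' by (simp add: funpow_swap1)
  finally show ?case by blast
qed simp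

lemma address_add:
  "address \<sigma> u f (i + k) a = (subst_word \<sigma> ^^ k) (address \<sigma> u f i a) @ address \<sigma> u f k ((f ^^ i) a)"
proof (induction i arbitrary: a)
  case (Suc i)
  have "(subst_word \<sigma> ^^ (i + k)) w = (subst_word \<sigma> ^^ k) ((subst_word \<sigma> ^^ i) w)" for w
    by (simp add: funpow_add add.commute[of i k])
  then show ?case by (simp add: Suc.IH funpow_swap1)
qed simp

lemma word_weight_nonneg:
  fixes lam :: "real ^ 'a"
  assumes "\<And>a. 0 < lam $ a"
  shows "0 \<le> word_weight lam w"
  by (induction w) (use assms in \<open>auto intro: add_nonneg_nonneg less_imp_le\<close>)

text \<open>What the proof uses of the field homomorphism is that \<open>\<gamma>\<close>-weights of words determine their
  \<open>\<lambda>\<close>-weights. Every algebraic identity below is therefore brought into the form of an equality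
  between the weights of two words.\<close>

locale conjugate_weights =
  expanding_weight \<sigma> \<gamma> \<theta>\<^sub>2 for \<sigma> :: "'a::finite \<Rightarrow> 'a list" and \<gamma> :: "real ^ 'a" and \<theta>\<^sub>2 :: real +
  fixes lam :: "real ^ 'a" and \<theta>\<^sub>1 :: real
  assumes less: "\<theta>\<^sub>2 < \<theta>\<^sub>1"
    and lam_pos: "\<And>a. 0 < lam $ a"
    and lam_image: "\<And>a. word_weight lam (\<sigma> a) = \<theta>\<^sub>1 * lam $ a"
    and conjugate: "\<And>U V. word_weight \<gamma> U = word_weight \<gamma> V \<Longrightarrow> word_weight lam U = word_weight lam V"
begin

lemma lam_iterate: "word_weight lam (iterate q w) = \<theta>\<^sub>1 ^ q * word_weight lam w"
  by (rule word_weight_funpow[OF lam_image])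

lemmas lam_nonneg = word_weight_nonneg[of lam, OF lam_pos]

lemma theta1_gt_1: "1 < \<theta>\<^sub>1"
  using less expanding by simp

text \<open>Fix an optimal selection \<open>f\<close> as in \<open>limit_min_attained\<close>. There are only finitely many maps on
  letters, so \<open>f\<^sup>i\<^sup>+\<^sup>k = f\<^sup>i\<close> for some \<open>k > 0\<close>, and subtracting the two equations for
  \<open>\<theta>\<^sub>2\<^sup>i\<^sup>+\<^sup>k m(a)\<close> and \<open>\<theta>\<^sub>2\<^sup>i m(a)\<close> eliminates the unknown remainder: \<open>(\<theta>\<^sub>2\<^sup>i\<^sup>+\<^sup>k - \<theta>\<^sub>2\<^sup>i) m(a)\<close> is a
  difference of weights of addresses. Multiplied by this factor, a vanishing gap is an equality of the
  \<open>\<gamma>\<close>-weights of two words. It transfers to \<open>\<lambda>\<close>, where addresses have weight at least \<open>0\<close> and at most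
  that of the word they are a prefix of, and these bounds contradict the equality.\<close>

lemma limit_gap_nonzero:
  assumes "v \<noteq> []"
  shows "word_weight \<gamma> (c # v) + limit_min d - limit_min c \<noteq> 0"
proof
  assume zero: "word_weight \<gamma> (c # v) + limit_min d - limit_min c = 0"
  obtain u f where uf: "\<And>a. \<exists>s. \<sigma> a = u a @ f a # s"
    "\<And>a. \<theta>\<^sub>2 * limit_min a = word_weight \<gamma> (u a) + limit_min (f a)"
    using limit_min_attained by metis
  define P where "P = address \<sigma> u f"
  have \<mu>: "\<theta>\<^sub>2 ^ j * limit_min a = word_weight \<gamma> (P j a) + limit_min ((f ^^ j) a)" for j a
  proof (induction j arbitrary: a)
    case (Suc j)
    have "\<theta>\<^sub>2 ^ Suc j * limit_min a = \<theta>\<^sub>2 ^ j * (\<theta>\<^sub>2 * limit_min a)" by simp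
    also have "\<dots> = \<theta>\<^sub>2 ^ j * word_weight \<gamma> (u a) + \<theta>\<^sub>2 ^ j * limit_min (f a)"
      unfolding uf(2) by (simp add: distrib_left)
    finally show ?case
      unfolding Suc.IH by (simp add: P_def weight_iterate funpow_swap1)
  qed (simp add: P_def)
  have "\<not> inj (\<lambda>i. f ^^ i)"
    using finite_imageD[of "\<lambda>i. f ^^ i" UNIV] by auto
  then obtain i j where "i \<noteq> j" "f ^^ i = f ^^ j"
    by (auto simp: inj_on_def)
  then obtain i k where k: "0 < k" "f ^^ (i + k) = f ^^ i"
    by (metis less_imp_add_positive linorder_neqE_nat)
  have \<gamma>P: "(\<theta>\<^sub>2 ^ (i + k) - \<theta>\<^sub>2 ^ i) * limit_min a
      = word_weight \<gamma> (P (i + k) a) - word_weight \<gamma> (P i a)" for a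
    using \<mu>[of "i + k" a] \<mu>[of i a] by (simp add: k left_diff_distrib)
  have "word_weight \<gamma> (iterate (i + k) (c # v) @ P (i + k) d @ P i c)
      - word_weight \<gamma> (iterate i (c # v) @ P i d @ P (i + k) c)
    = (\<theta>\<^sub>2 ^ (i + k) - \<theta>\<^sub>2 ^ i) * (word_weight \<gamma> (c # v) + limit_min d - limit_min c)"
    unfolding right_diff_distrib distrib_left \<gamma>P
    by (simp add: weight_iterate del: word_weight_simps(2)) (simp add: algebra_simps)
  then have "word_weight \<gamma> (iterate (i + k) (c # v) @ P (i + k) d @ P i c)
      = word_weight \<gamma> (iterate i (c # v) @ P i d @ P (i + k) c)"
    unfolding zero by simp
  then have eq: "word_weight lam (iterate (i + k) (c # v) @ P (i + k) d @ P i c)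
      = word_weight lam (iterate i (c # v) @ P i d @ P (i + k) c)"
    by (rule conjugate)
  \<comment> \<open>\<open>E a\<close> is \<open>(\<theta>\<^sub>1\<^sup>i\<^sup>+\<^sup>k - \<theta>\<^sub>1\<^sup>i) \<nu>(a)\<close> for the \<open>\<lambda>\<close>-position \<open>\<nu>(a)\<close> of the minimum in \<open>a\<close>;
    the two bounds to be shown say \<open>0 \<le> \<nu>(d)\<close> and \<open>\<nu>(c) \<le> \<lambda>(c)\<close>.\<close>
  define E where "E = (\<lambda>a. word_weight lam (P (i + k) a) - word_weight lam (P i a))"
  have pow: "1 < \<theta>\<^sub>1 ^ k" using theta1_gt_1 k(1) by simp
  have E: "E a = (\<theta>\<^sub>1 ^ k - 1) * word_weight lam (P i a) + word_weight lam (P k ((f ^^ i) a))" for a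
    unfolding E_def P_def address_add by (simp add: lam_iterate algebra_simps)
  have "0 \<le> E d"
    unfolding E using pow lam_nonneg by (intro add_nonneg_nonneg mult_nonneg_nonneg) auto
  have "E c \<le> (\<theta>\<^sub>1 ^ (i + k) - \<theta>\<^sub>1 ^ i) * lam $ c"
  proof -
    \<comment> \<open>\<open>e\<close> lies on the cycle of \<open>f\<close>, so \<open>P k e\<close> is followed by \<open>e\<close> itself in \<open>\<sigma>\<^sup>k(e)\<close>.\<close>
    define e where "e = (f ^^ i) c"
    have "(f ^^ k) e = e"
      using fun_cong[OF k(2), of c] unfolding e_def by (simp add: funpow_add add.commute[of i k])
    then obtain s where s: "iterate k [e] = P k e @ e # s"
      using address_prefix[of \<sigma> u f k e, OF uf(1)] unfolding P_def by auto
    obtain s' where s': "iterate i [c] = P i c @ e # s'"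
      using address_prefix[of \<sigma> u f i c, OF uf(1)] unfolding P_def e_def by auto
    have "word_weight lam (P k e) \<le> (\<theta>\<^sub>1 ^ k - 1) * lam $ e"
      using lam_iterate[of k "[e]"] lam_nonneg[of s] unfolding s by (simp add: algebra_simps)
    moreover have "word_weight lam (P i c) + lam $ e \<le> \<theta>\<^sub>1 ^ i * lam $ c"
      using lam_iterate[of i "[c]"] lam_nonneg[of s'] unfolding s' by simp
    then have "(\<theta>\<^sub>1 ^ k - 1) * (word_weight lam (P i c) + lam $ e)
        \<le> (\<theta>\<^sub>1 ^ k - 1) * (\<theta>\<^sub>1 ^ i * lam $ c)"
      using pow by (intro mult_left_mono) auto
    ultimately show ?thesis
      unfolding E e_def[symmetric] by (simp add: algebra_simps power_add)
  qed
  moreover have "0 < word_weight lam v"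
    using assms lam_pos lam_nonneg by (cases v) (auto intro: add_pos_nonneg)
  then have "0 < (\<theta>\<^sub>1 ^ (i + k) - \<theta>\<^sub>1 ^ i) * word_weight lam v"
    using pow theta1_gt_1 by (simp add: power_add)
  moreover have "(\<theta>\<^sub>1 ^ (i + k) - \<theta>\<^sub>1 ^ i) * (lam $ c + word_weight lam v) + E d - E c = 0"
    using eq unfolding E_def by (simp add: lam_iterate del: word_weight_simps(2)) (simp add: algebra_simps)
  ultimately show False
    using \<open>0 \<le> E d\<close> by (simp add: distrib_left)
qed

text \<open>Separators of bounded length leave finitely many gaps, each converging to a nonzero limit as \<open>q\<close>
  grows.\<close>

lemma gap_bounded_below:
  obtains \<delta> q0 where "0 < \<delta>"
    "\<And>q c v d. q0 \<le> q \<Longrightarrow> v \<noteq> [] \<Longrightarrow> length v \<le> K \<Longrightarrow>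
      \<delta> \<le> \<bar>word_weight \<gamma> (c # v) + scaled_min q d - scaled_min q c\<bar>"
proof -
  define T :: "('a \<times> 'a list \<times> 'a) set"
    where "T = UNIV \<times> {v. v \<noteq> [] \<and> length v \<le> K} \<times> UNIV"
  define gap where
    "gap = (\<lambda>(c, v, d). \<bar>word_weight \<gamma> (c # v) + limit_min d - limit_min c\<bar>)"
  have "finite {v :: 'a list. v \<noteq> [] \<and> length v \<le> K}"
    by (rule finite_subset[OF _ finite_lists_length_le[of UNIV K]]) auto
  then have fin: "finite T" unfolding T_def by (intro finite_cartesian_product) auto
  \<comment> \<open>The element \<open>1\<close> keeps the minimum defined when there are no separators at all, i.e. for
    \<open>K = 0\<close>; halving leaves room for the convergence.\<close>
  define \<delta> where "\<delta> = Min (insert 1 (gap ` T)) / 2"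
  have gap_pos: "0 < gap z" if "z \<in> T" for z
    using that limit_gap_nonzero by (auto simp: T_def gap_def)
  have "0 < \<delta>"
    unfolding \<delta>_def using fin gap_pos by simp
  have "\<forall>\<^sub>F q in sequentially. case z of (c, v, d) \<Rightarrow>
      \<delta> < \<bar>word_weight \<gamma> (c # v) + scaled_min q d - scaled_min q c\<bar>" if "z \<in> T" for z
  proof -
    obtain c v d where z: "z = (c, v, d)" by (cases z)
    have "Min (insert 1 (gap ` T)) \<le> gap z"
      using that fin by (intro Min_le) auto
    then have "\<delta> < gap z" using gap_pos[OF that] unfolding \<delta>_def by linarith
    moreover have "(\<lambda>q. \<bar>word_weight \<gamma> (c # v) + scaled_min q d - scaled_min q c\<bar>) \<longlonglongrightarrow> gap z"
      unfolding z gap_def by (auto intro!: tendsto_intros scaled_min_tendsto)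
    ultimately show ?thesis
      unfolding z by (auto dest: order_tendstoD(1))
  qed
  then have "\<forall>\<^sub>F q in sequentially. \<forall>z\<in>T. case z of (c, v, d) \<Rightarrow>
      \<delta> < \<bar>word_weight \<gamma> (c # v) + scaled_min q d - scaled_min q c\<bar>"
    using fin by (simp add: eventually_ball_finite_distrib)
  then obtain q0 where q0: "\<And>q z. q0 \<le> q \<Longrightarrow> z \<in> T \<Longrightarrow> case z of (c, v, d) \<Rightarrow>
      \<delta> < \<bar>word_weight \<gamma> (c # v) + scaled_min q d - scaled_min q c\<bar>"
    unfolding eventually_sequentially by blast
  show thesis
  proof (rule that[OF \<open>0 < \<delta>\<close>])
    fix q c d and v :: "'a list"
    assume "q0 \<le> q" "v \<noteq> []" "length v \<le> K"
    then show "\<delta> \<le> \<bar>word_weight \<gamma> (c # v) + scaled_min q d - scaled_min q c\<bar>"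
      using q0[of q "(c, v, d)"] by (simp add: T_def)
  qed
qed

text \<open>With \<open>y\<close> the weight up to the block of \<open>c\<close>, the minimal values of \<open>g\<close> on the two blocks are
  \<open>y + \<theta>\<^sub>2\<^sup>q m\<^sub>q(c)\<close> and \<open>y + \<theta>\<^sub>2\<^sup>q (\<gamma>(cv) + m\<^sub>q(d))\<close>, which differ by \<open>\<theta>\<^sub>2\<^sup>q\<close> times the gap.
  The minimizing cut has the smaller of the two as its value, and the other cut has at least the
  larger one. The modulus covers the two possible directions, hence both sides of the origin at once.\<close>

lemma gap_at_minimizer:
  fixes W v Y Z :: "'a list" and c d :: 'a
  defines "g \<equiv> \<lambda>k. word_weight \<gamma> (take k W)"
  assumes W: "W = Y @ iterate q (c # v @ [d]) @ Z"
    and s: "length Y \<le> s" "s < length (Y @ iterate q [c])"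
    and t: "length (Y @ iterate q (c # v)) \<le> t" "t < length (Y @ iterate q (c # v @ [d]))"
    and m: "m = s \<or> m = t"
    and min_c: "\<And>k. length Y \<le> k \<Longrightarrow> k < length (Y @ iterate q [c]) \<Longrightarrow> g m \<le> g k"
    and min_d: "\<And>k. length (Y @ iterate q (c # v)) \<le> k \<Longrightarrow>
      k < length (Y @ iterate q (c # v @ [d])) \<Longrightarrow> g m \<le> g k"
  shows "\<theta>\<^sub>2 ^ q * \<bar>word_weight \<gamma> (c # v) + scaled_min q d - scaled_min q c\<bar> \<le> \<bar>g t - g s\<bar>"
proof -
  have app: "iterate q (c # w) = iterate q [c] @ iterate q w" for c w
    using funpow_subst_word_append[of q \<sigma> "[c]" w] by simp
  have Wc: "W = Y @ iterate q [c] @ iterate q (v @ [d]) @ Z"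
    unfolding W app[of c "v @ [d]"] by simp
  have Wd: "W = (Y @ iterate q (c # v)) @ iterate q [d] @ Z"
    unfolding W app[of c "v @ [d]"] app[of c v] by simp
  define y where "y = word_weight \<gamma> Y"
  have g_c: "g k = y + word_weight \<gamma> (take (k - length Y) (iterate q [c]))"
    if "length Y \<le> k" "k < length (Y @ iterate q [c])" for k
    using that unfolding g_def Wc y_def by simp
  have g_d: "g k = y + \<theta>\<^sub>2 ^ q * word_weight \<gamma> (c # v)
      + word_weight \<gamma> (take (k - length (Y @ iterate q (c # v))) (iterate q [d]))"
    if "length (Y @ iterate q (c # v)) \<le> k" "k < length (Y @ iterate q (c # v @ [d]))" for k
  proof -
    have "take k W = Y @ iterate q (c # v)
        @ take (k - length (Y @ iterate q (c # v))) (iterate q [d])"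
      using that unfolding Wd app[of c "v @ [d]"] app[of c v] by (simp add: add.assoc)
    then show ?thesis
      unfolding g_def y_def by (simp only: word_weight_simps(3) weight_iterate add.assoc)
  qed
  have lower_c: "y + \<theta>\<^sub>2 ^ q * scaled_min q c \<le> g s"
    unfolding g_c[OF s] scaled_min_mult using s by (simp add: min_prefix_weight_le)
  have lower_d: "y + \<theta>\<^sub>2 ^ q * word_weight \<gamma> (c # v) + \<theta>\<^sub>2 ^ q * scaled_min q d \<le> g t"
    unfolding g_d[OF t] scaled_min_mult using t app[of c "v @ [d]"] app[of c v]
    by (simp add: min_prefix_weight_le)
  have ne: "iterate q [e] \<noteq> []" for e by (rule iterate_nonempty) simp
  obtain i where i: "i < length (iterate q [c])"
    "min_prefix_weight \<gamma> (iterate q [c]) = word_weight \<gamma> (take i (iterate q [c]))"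
    using min_prefix_weight_attained[OF ne] by blast
  have "g m \<le> g (length Y + i)" using i by (intro min_c) auto
  also have "\<dots> = y + \<theta>\<^sub>2 ^ q * scaled_min q c"
    using i by (simp add: g_c scaled_min_mult)
  finally have upper_c: "g m \<le> y + \<theta>\<^sub>2 ^ q * scaled_min q c" .
  obtain j where j: "j < length (iterate q [d])"
    "min_prefix_weight \<gamma> (iterate q [d]) = word_weight \<gamma> (take j (iterate q [d]))"
    using min_prefix_weight_attained[OF ne] by blast
  let ?k = "length (Y @ iterate q (c # v)) + j"
  have k: "length (Y @ iterate q (c # v)) \<le> ?k" "?k < length (Y @ iterate q (c # v @ [d]))"
    using j(1) app[of c "v @ [d]"] app[of c v] by simp_all
  have "g m \<le> g ?k" using k by (rule min_d)
  also have "\<dots> = y + \<theta>\<^sub>2 ^ q * word_weight \<gamma> (c # v) + \<theta>\<^sub>2 ^ q * scaled_min q d"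
    unfolding g_d[OF k] scaled_min_mult j(2) by simp
  finally have upper_d:
    "g m \<le> y + \<theta>\<^sub>2 ^ q * word_weight \<gamma> (c # v) + \<theta>\<^sub>2 ^ q * scaled_min q d" .
  have "\<bar>\<theta>\<^sub>2 ^ q * (word_weight \<gamma> (c # v) + scaled_min q d - scaled_min q c)\<bar> \<le> \<bar>g t - g s\<bar>"
    unfolding right_diff_distrib distrib_left using m lower_c lower_d upper_c upper_d by auto
  then show ?thesis using expanding by (simp add: abs_mult)
qed

text \<open>The levels and letters of \<open>separated_blocks\<close> are fed into \<open>gap_at_minimizer\<close>; \<open>\<lambda>\<close>-weights compare
  lengths with powers of \<open>\<theta>\<^sub>1\<close>. The blocks of the cuts have length at most a constant times \<open>t - s\<close>,
  because \<open>\<sigma>\<^sup>q(v)\<close> fits between the cuts, so it is enough that \<open>m\<close> is minimal within radius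
  \<open>\<rho> (t - s)\<close>. Conversely \<open>t - s \<le> D \<theta>\<^sub>1\<^sup>q\<close>, so large distances force large levels, where
  the gaps exceed \<open>\<delta>\<close>.\<close>

lemma growth_at_minimizer:
  "\<exists>\<kappa> n0 \<rho>. 0 < \<kappa> \<and> (\<forall>N a s t m. s + n0 \<le> t \<longrightarrow> t < length (iterate N [a]) \<longrightarrow> m \<in> {s, t} \<longrightarrow>
    minimal_prefix_within \<gamma> (iterate N [a]) (\<rho> * real (t - s)) m \<longrightarrow>
    \<kappa> * real (t - s) powr (ln \<theta>\<^sub>2 / ln \<theta>\<^sub>1)
      \<le> \<bar>word_weight \<gamma> (take t (iterate N [a])) - word_weight \<gamma> (take s (iterate N [a]))\<bar>)"
proof -
  define \<alpha> where "\<alpha> = ln \<theta>\<^sub>2 / ln \<theta>\<^sub>1"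
  have "0 < \<alpha>" using expanding theta1_gt_1 by (simp add: \<alpha>_def)
  have \<theta>\<alpha>: "(\<theta>\<^sub>1 ^ q) powr \<alpha> = \<theta>\<^sub>2 ^ q" for q
  proof -
    have "\<theta>\<^sub>1 powr \<alpha> = \<theta>\<^sub>2"
      using theta1_gt_1 expanding by (simp add: \<alpha>_def powr_def)
    then show ?thesis
      using theta1_gt_1 expanding
      by (metis (no_types, lifting) less_trans mult.commute powr_powr powr_realpow zero_less_one)
  qed
  define L where "L = Max (range (\<lambda>a. length (\<sigma> a)))"
  have L: "length (\<sigma> a) \<le> L" for a unfolding L_def by (intro Max_ge) auto
  define l u where "l = Min (range (($) lam :: 'a \<Rightarrow> real))" and "u = Max (range (($) lam :: 'a \<Rightarrow> real))"
  have "0 < l" unfolding l_def using lam_pos by simp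
  have "l \<le> lam $ a" "lam $ a \<le> u" for a
    unfolding l_def u_def by simp_all
  then have len: "l * real (length w) \<le> word_weight lam w" "word_weight lam w \<le> u * real (length w)"
    for w by (induction w) (auto simp: distrib_left intro: add_mono)
  have "0 < u" using \<open>0 < l\<close> \<open>\<And>a. l \<le> lam $ a\<close> \<open>\<And>a. lam $ a \<le> u\<close> by (meson less_le_trans)
  \<comment> \<open>\<open>(u / l)\<^sup>2\<close> bounds the length of a block relative to \<open>t - s\<close>; one more \<open>t - s\<close> leads from
    \<open>m\<close> to the cut in the other block.\<close>
  define \<rho> where "\<rho> = (u / l)\<^sup>2 + 1"
  \<comment> \<open>\<open>2 * L + 2\<close> bounds the length of \<open>c # v @ [d]\<close>, and \<open>u * \<theta>\<^sub>1 ^ q / l\<close> the length of the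
    image of one letter.\<close>
  define D where "D = u * (2 * real L + 2) / l"
  have "0 < D" using \<open>0 < l\<close> \<open>0 < u\<close> by (simp add: D_def add_nonneg_pos)
  obtain \<delta> q0 where \<delta>: "0 < \<delta>" "\<And>q c v d. q0 \<le> q \<Longrightarrow> v \<noteq> [] \<Longrightarrow> length v \<le> 2 * L \<Longrightarrow>
      \<delta> \<le> \<bar>word_weight \<gamma> (c # v) + scaled_min q d - scaled_min q c\<bar>"
    using gap_bounded_below[of "2 * L"] by blast
  \<comment> \<open>The summand \<open>2\<close> provides the distance that \<open>separated_blocks\<close> asks for.\<close>
  define n0 where "n0 = nat \<lceil>D * \<theta>\<^sub>1 ^ q0\<rceil> + 2"
  define \<kappa> where "\<kappa> = \<delta> / D powr \<alpha>"
  have "0 < \<kappa>" using \<delta>(1) \<open>0 < D\<close> by (simp add: \<kappa>_def)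
  show ?thesis
  proof (intro exI conjI allI impI)
    fix N a s t m
    define W where "W = iterate N [a]"
    assume n0: "s + n0 \<le> t" and "t < length (iterate N [a])" and "m \<in> {s, t}"
      and min: "minimal_prefix_within \<gamma> (iterate N [a]) (\<rho> * real (t - s)) m"
    then have t: "t < length W" and m: "m = s \<or> m = t"
      by (simp_all add: W_def)
    have minimizer: "word_weight \<gamma> (take m W) \<le> word_weight \<gamma> (take k W)"
      if "k < length W" "\<bar>real k - real m\<bar> \<le> \<rho> * real (t - s)" for k
      using min that by (simp add: minimal_prefix_within_def W_def)
    define n where "n = t - s"
    have st: "s + 2 \<le> t" using n0 by (simp add: n0_def)
    obtain q c v d Y Z where K: "W = Y @ iterate q (c # v @ [d]) @ Z"
      "v \<noteq> []" "length v \<le> 2 * L" "length Y \<le> s" "s < length (Y @ iterate q [c])"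
      "length (Y @ iterate q (c # v)) \<le> t" "t < length (Y @ iterate q (c # v @ [d]))"
      using separated_blocks[of \<sigma> L "[a]" s t N, OF L] st t unfolding W_def by auto
    have app: "iterate q (c # w) = iterate q [c] @ iterate q w" for c w
      using funpow_subst_word_append[of q \<sigma> "[c]" w] by simp
    have block: "real (length (iterate q [e])) \<le> (u / l)\<^sup>2 * real n" for e
    proof -
      have "l * real (length (iterate q [e])) \<le> \<theta>\<^sub>1 ^ q * (u * 1)"
        using len(1)[of "iterate q [e]"] len(2)[of "[e]"] theta1_gt_1
        unfolding lam_iterate by (auto elim!: order_trans intro!: mult_left_mono)
      moreover have "\<theta>\<^sub>1 ^ q * l \<le> u * real n"
      proof -
        have "length (iterate q v) \<le> n"
          using K(5,6) unfolding n_def app[of c v] by simp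
        have "l * 1 \<le> l * real (length v)"
          using \<open>0 < l\<close> K(2) by (intro mult_left_mono) (auto simp: Suc_le_eq)
        also have "\<dots> \<le> word_weight lam v" by (rule len(1))
        finally have "\<theta>\<^sub>1 ^ q * l \<le> \<theta>\<^sub>1 ^ q * word_weight lam v"
          using theta1_gt_1 by (intro mult_left_mono) auto
        also have "\<dots> \<le> u * real (length (iterate q v))"
          using len(2)[of "iterate q v"] unfolding lam_iterate .
        also have "\<dots> \<le> u * real n"
          using \<open>length (iterate q v) \<le> n\<close> \<open>0 < u\<close> by (intro mult_left_mono) auto
        finally show ?thesis .
      qed
      ultimately have "real (length (iterate q [e])) \<le> \<theta>\<^sub>1 ^ q * u / l" "\<theta>\<^sub>1 ^ q \<le> u * real n / l"
        using \<open>0 < l\<close> by (simp_all add: field_simps)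
      moreover have "\<theta>\<^sub>1 ^ q * u / l \<le> u * real n / l * u / l"
        using calculation(2) \<open>0 < l\<close> \<open>0 < u\<close> by (intro divide_right_mono mult_right_mono) auto
      ultimately show ?thesis by (simp add: power2_eq_square field_simps)
    qed
    have blocks: "\<theta>\<^sub>2 ^ q * \<bar>word_weight \<gamma> (c # v) + scaled_min q d - scaled_min q c\<bar>
        \<le> \<bar>word_weight \<gamma> (take t W) - word_weight \<gamma> (take s W)\<bar>"
    proof (rule gap_at_minimizer[OF K(1,4-7) m])
      fix k assume k: "length Y \<le> k" "k < length (Y @ iterate q [c])"
      have "\<bar>real k - real s\<bar> \<le> real (length (iterate q [c]))" using k K(4,5) by auto
      then have "\<bar>real k - real m\<bar> \<le> (u / l)\<^sup>2 * real n + real n"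
        using block[of c] m st unfolding n_def by auto
      moreover have "k < length W" using k unfolding K(1) app[of c "v @ [d]"] by simp
      ultimately show "word_weight \<gamma> (take m W) \<le> word_weight \<gamma> (take k W)"
        by (intro minimizer) (auto simp: \<rho>_def n_def distrib_right)
    next
      fix k assume k: "length (Y @ iterate q (c # v)) \<le> k" "k < length (Y @ iterate q (c # v @ [d]))"
      have "\<bar>real k - real t\<bar> \<le> real (length (iterate q [d]))"
        using k K(6,7) app[of c v] app[of c "v @ [d]"] by auto
      then have "\<bar>real k - real m\<bar> \<le> (u / l)\<^sup>2 * real n + real n"
        using block[of d] m st unfolding n_def by auto
      moreover have "k < length W" using k unfolding K(1) by simp
      ultimately show "word_weight \<gamma> (take m W) \<le> word_weight \<gamma> (take k W)"
        by (intro minimizer) (auto simp: \<rho>_def n_def distrib_right)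
    qed
    have nD: "real n \<le> D * \<theta>\<^sub>1 ^ q"
    proof -
      have "n \<le> length (iterate q (c # v @ [d]))"
        using K(4,7) unfolding n_def by simp
      then have "l * real n \<le> l * real (length (iterate q (c # v @ [d])))"
        using \<open>0 < l\<close> by (intro mult_left_mono) auto
      also have "\<dots> \<le> \<theta>\<^sub>1 ^ q * word_weight lam (c # v @ [d])"
        using len(1)[of "iterate q (c # v @ [d])"] unfolding lam_iterate .
      also have "\<dots> \<le> \<theta>\<^sub>1 ^ q * (u * real (length (c # v @ [d])))"
        using theta1_gt_1 by (intro mult_left_mono len) auto
      also have "\<dots> \<le> \<theta>\<^sub>1 ^ q * (u * (2 * real L + 2))"
        using theta1_gt_1 \<open>0 < u\<close> K(3) by (intro mult_left_mono) auto
      finally show ?thesis using \<open>0 < l\<close> by (simp add: D_def field_simps)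
    qed
    have "D * \<theta>\<^sub>1 ^ q0 < real n"
      using n0 unfolding n_def n0_def by linarith
    then have "D * \<theta>\<^sub>1 ^ q0 < D * \<theta>\<^sub>1 ^ q" using nD by linarith
    then have "q0 \<le> q" using \<open>0 < D\<close> theta1_gt_1 by simp
    have "real n powr \<alpha> \<le> (D * \<theta>\<^sub>1 ^ q) powr \<alpha>"
      using nD \<open>0 < \<alpha>\<close> by (intro powr_mono2) auto
    also have "\<dots> = D powr \<alpha> * \<theta>\<^sub>2 ^ q"
      using \<open>0 < D\<close> theta1_gt_1 by (simp add: powr_mult \<theta>\<alpha>)
    finally have "\<kappa> * real n powr \<alpha> \<le> \<kappa> * (D powr \<alpha> * \<theta>\<^sub>2 ^ q)"
      using \<open>0 < \<kappa>\<close> by (intro mult_left_mono) auto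
    also have "\<dots> = \<theta>\<^sub>2 ^ q * \<delta>" using \<open>0 < D\<close> by (simp add: \<kappa>_def)
    also have "\<dots> \<le> \<theta>\<^sub>2 ^ q * \<bar>word_weight \<gamma> (c # v) + scaled_min q d - scaled_min q c\<bar>"
      using \<delta>(2)[OF \<open>q0 \<le> q\<close> K(2,3)] expanding by (intro mult_left_mono) auto
    also note blocks
    finally show "\<kappa> * real (t - s) powr (ln \<theta>\<^sub>2 / ln \<theta>\<^sub>1)
        \<le> \<bar>word_weight \<gamma> (take t (iterate N [a])) - word_weight \<gamma> (take s (iterate N [a]))\<bar>"
      unfolding n_def \<alpha>_def W_def .
  qed (fact \<open>0 < \<kappa>\<close>)
qed

end

section \<open>Minimal points\<close>

lemma word_weight_map_upto: "word_weight \<gamma> (map x [i..j]) = (\<Sum>k\<in>{i..j}. \<gamma> $ x k)"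
  by (simp add: word_weight_def interv_sum_list_conv_sum_set_int o_def)

lemma partial_weight_from:
  assumes "0 \<le> R" "- R \<le> m"
  shows "partial_weight \<gamma> x m = (\<Sum>i\<in>{-R..<m}. \<gamma> $ x i) - (\<Sum>i\<in>{-R..<0}. \<gamma> $ x i)"
proof (cases "0 \<le> m")
  case True
  have "{-R..<m} = {-R..<0} \<union> {0..<m}" using True assms by auto
  then have "(\<Sum>i\<in>{-R..<m}. \<gamma> $ x i) = (\<Sum>i\<in>{-R..<0}. \<gamma> $ x i) + (\<Sum>i\<in>{0..<m}. \<gamma> $ x i)"
    by (auto intro: sum.union_disjoint)
  then show ?thesis using True by (simp add: partial_weight_def)
next
  case False
  have "{-R..<0} = {-R..<m} \<union> {m..-1}" using False assms by auto
  then have "(\<Sum>i\<in>{-R..<0}. \<gamma> $ x i) = (\<Sum>i\<in>{-R..<m}. \<gamma> $ x i) + (\<Sum>i\<in>{m..-1}. \<gamma> $ x i)"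
    by (auto intro: sum.union_disjoint)
  then show ?thesis using False by (simp add: partial_weight_def)
qed

text \<open>Places the origin of \<open>x\<close> at position \<open>p\<close> of an iterated image of a letter, with at least \<open>R\<close>
  letters on either side.\<close>

lemma subst_shift_window:
  assumes "x \<in> subst_shift \<sigma>"
  shows "\<exists>N a p. R \<le> p \<and> p + R < length ((subst_word \<sigma> ^^ N) [a]) \<and>
    (\<forall>k. p \<le> k + R \<longrightarrow> k \<le> p + R \<longrightarrow>
      partial_weight \<gamma> x (int k - int p) = word_weight \<gamma> (take k ((subst_word \<sigma> ^^ N) [a]))
        - word_weight \<gamma> (take p ((subst_word \<sigma> ^^ N) [a])))"
proof -
  obtain N a where "sublist (map x [- int R..int R]) ((subst_word \<sigma> ^^ N) [a])"
    using assms unfolding subst_shift_def by blast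
  then obtain ps ss where W: "(subst_word \<sigma> ^^ N) [a] = ps @ map x [- int R..int R] @ ss"
    by (auto simp: sublist_def)
  define p where "p = length ps + R"
  have g: "word_weight \<gamma> (take k ((subst_word \<sigma> ^^ N) [a]))
      = word_weight \<gamma> ps + (\<Sum>i\<in>{- int R..<int k - int p}. \<gamma> $ x i)"
    if k: "p \<le> k + R" "k \<le> p + R" for k
  proof -
    define m where "m = int k - int p"
    have m: "- int R \<le> m" "m \<le> int R" using k by (auto simp: m_def)
    have split: "[- int R..int R] = [- int R..m - 1] @ [m..int R]"
      using upto_split1[OF m] .
    have "k = length ps + length [- int R..m - 1]"
      using k by (simp add: m_def p_def)
    then have "take k ((subst_word \<sigma> ^^ N) [a]) = ps @ map x [- int R..m - 1]"
      unfolding W split by simp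
    moreover have "{- int R..m - 1} = {- int R..<m}" by auto
    ultimately show ?thesis by (simp add: word_weight_map_upto m_def)
  qed
  show ?thesis
  proof (intro exI conjI allI impI)
    fix k assume k: "p \<le> k + R" "k \<le> p + R"
    show "partial_weight \<gamma> x (int k - int p) = word_weight \<gamma> (take k ((subst_word \<sigma> ^^ N) [a]))
        - word_weight \<gamma> (take p ((subst_word \<sigma> ^^ N) [a]))"
      using partial_weight_from[of "int R" "int k - int p" \<gamma> x] k
      unfolding g[OF k] g[of p, simplified] by simp
  qed (simp_all add: p_def W)
qed

text \<open>The origin \<open>p\<close> is the left cut for the forward estimate and the right cut for the backward one. The
  modulus in \<open>growth_at_minimizer\<close> disappears since partial weights of a minimal point are
  nonnegative.\<close>

lemma (in conjugate_weights) minimal_point_growth: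
  assumes "minimal_point \<sigma> \<gamma> x"
  obtains \<kappa> n0 where "0 < \<kappa>"
    "\<And>n. n0 \<le> n \<Longrightarrow> \<kappa> * real n powr (ln \<theta>\<^sub>2 / ln \<theta>\<^sub>1) \<le> partial_weight \<gamma> x (int n)"
    "\<And>n. n0 \<le> n \<Longrightarrow> \<kappa> * real n powr (ln \<theta>\<^sub>2 / ln \<theta>\<^sub>1) \<le> partial_weight \<gamma> x (- int n)"
proof -
  have x: "x \<in> subst_shift \<sigma>" and pos: "\<And>m. 0 \<le> partial_weight \<gamma> x m"
    using assms by (auto simp: minimal_point_def)
  obtain \<kappa> n0 \<rho> where "0 < \<kappa>" and growth: "\<forall>N a s t m. s + n0 \<le> t \<longrightarrow>
    t < length (iterate N [a]) \<longrightarrow> m \<in> {s, t} \<longrightarrow>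
    minimal_prefix_within \<gamma> (iterate N [a]) (\<rho> * real (t - s)) m \<longrightarrow>
    \<kappa> * real (t - s) powr (ln \<theta>\<^sub>2 / ln \<theta>\<^sub>1)
      \<le> \<bar>word_weight \<gamma> (take t (iterate N [a])) - word_weight \<gamma> (take s (iterate N [a]))\<bar>"
    using growth_at_minimizer by (elim exE conjE that)
  have both: "\<kappa> * real n powr (ln \<theta>\<^sub>2 / ln \<theta>\<^sub>1) \<le> partial_weight \<gamma> x (int n)
      \<and> \<kappa> * real n powr (ln \<theta>\<^sub>2 / ln \<theta>\<^sub>1) \<le> partial_weight \<gamma> x (- int n)" if n: "n0 \<le> n" for n
  proof -
    \<comment> \<open>The window has to contain the second cut and the region where minimality is needed.\<close>
    define R where "R = n + nat \<lceil>\<rho> * real n\<rceil>"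
    obtain N a p where p: "R \<le> p" "p + R < length (iterate N [a])"
      and window: "\<forall>k. p \<le> k + R \<longrightarrow> k \<le> p + R \<longrightarrow>
        partial_weight \<gamma> x (int k - int p) = word_weight \<gamma> (take k (iterate N [a]))
          - word_weight \<gamma> (take p (iterate N [a]))"
      using subst_shift_window[OF x, of R \<gamma>] by (elim exE conjE that)
    have minimizer: "minimal_prefix_within \<gamma> (iterate N [a]) (\<rho> * real n) p"
      unfolding minimal_prefix_within_def
    proof (intro allI impI)
      fix k assume "\<bar>real k - real p\<bar> \<le> \<rho> * real n"
      then have "p \<le> k + R" "k \<le> p + R" unfolding R_def by linarith+
      then show "word_weight \<gamma> (take p (iterate N [a])) \<le> word_weight \<gamma> (take k (iterate N [a]))"
        using window[rule_format, of k] pos[of "int k - int p"] by simp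
    qed
    have R: "n \<le> R" by (simp add: R_def)
    have shift: "p + n - p = n" "p - (p - n) = n" "int (p + n) - int p = int n"
      "int (p - n) - int p = - int n"
      using R p(1) by auto
    define g where "g = (\<lambda>k. word_weight \<gamma> (take k (iterate N [a])))"
    have "\<kappa> * real (p + n - p) powr (ln \<theta>\<^sub>2 / ln \<theta>\<^sub>1) \<le> \<bar>g (p + n) - g p\<bar>"
      unfolding g_def
      by (rule growth[rule_format, where m = p])
        (use n R p(2) minimizer in \<open>simp_all only: shift, simp_all\<close>)
    moreover have "g (p + n) - g p = partial_weight \<gamma> x (int n)"
      unfolding g_def shift(3)[symmetric] using R by (intro window[rule_format, symmetric]) auto
    moreover have "\<kappa> * real (p - (p - n)) powr (ln \<theta>\<^sub>2 / ln \<theta>\<^sub>1) \<le> \<bar>g p - g (p - n)\<bar>"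
      unfolding g_def
      by (rule growth[rule_format, where m = p])
        (use n R p(1,2) minimizer in \<open>simp_all only: shift, simp_all\<close>)
    moreover have "g (p - n) - g p = partial_weight \<gamma> x (- int n)"
      unfolding g_def shift(4)[symmetric] using R by (intro window[rule_format, symmetric]) auto
    ultimately show ?thesis
      unfolding shift using pos[of "int n"] pos[of "- int n"] by linarith
  qed
  show thesis by (rule that[OF \<open>0 < \<kappa>\<close>, of n0]) (use both in auto)
qed

section \<open>The conjugate eigenvector\<close>

lemma poly_of_rat_add:
  "poly (map_poly of_rat (p + q)) x = poly (map_poly of_rat p) x + poly (map_poly of_rat q) (x :: real)"
proof -
  have "map_poly of_rat (p + q) = map_poly of_rat p + (map_poly of_rat q :: real poly)"
    by (intro poly_eqI) (simp add: coeff_map_poly of_rat_add)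
  then show ?thesis by simp
qed

lemma poly_of_rat_mult:
  "poly (map_poly of_rat (p * q)) x = poly (map_poly of_rat p) x * poly (map_poly of_rat q) (x :: real)"
proof -
  have "map_poly of_rat (p * q) = map_poly of_rat p * (map_poly of_rat q :: real poly)"
    by (intro poly_eqI) (simp add: coeff_map_poly coeff_mult of_rat_sum of_rat_mult)
  then show ?thesis by simp
qed

lemma rat_adjoin_add: "y \<in> rat_adjoin \<alpha> \<Longrightarrow> z \<in> rat_adjoin \<alpha> \<Longrightarrow> y + z \<in> rat_adjoin \<alpha>"
  unfolding rat_adjoin_def by (auto simp flip: poly_of_rat_add)

lemma rat_adjoin_diff: 
  assumes "y \<in> rat_adjoin \<alpha>" "z \<in> rat_adjoin \<alpha>"
  shows "y - z \<in> rat_adjoin \<alpha>"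
proof -
  obtain p q where pq: "y = poly (map_poly of_rat p) \<alpha>" "z = poly (map_poly of_rat q) \<alpha>"
    using assms by (auto simp: rat_adjoin_def)
  then have "y - z = poly (map_poly of_rat (p - q)) \<alpha>"
    using poly_of_rat_add[of "p - q" q \<alpha>] by simp
  then show ?thesis by (auto simp: rat_adjoin_def)
qed

lemma rat_adjoin_0: "0 \<in> rat_adjoin \<alpha>"
  unfolding rat_adjoin_def by (intro range_eqI[of _ _ 0]) simp

lemma rat_adjoin_self: "\<alpha> \<in> rat_adjoin \<alpha>"
  unfolding rat_adjoin_def by (intro range_eqI[of _ _ "[:0, 1:]"]) (simp add: map_poly_pCons)

text \<open>An irreducible polynomial that vanishes at \<open>\<alpha>\<close> is coprime to every polynomial that does not, and a
  Bezout identity evaluated at \<open>\<alpha>\<close> provides the inverse.\<close>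

lemma rat_adjoin_inverse:
  assumes "irreducible (p :: rat poly)" "poly (map_poly of_rat p) \<alpha> = 0"
    and "z \<in> rat_adjoin \<alpha>" "z \<noteq> 0"
  shows "\<exists>z'\<in>rat_adjoin \<alpha>. z * z' = 1"
proof -
  obtain r where r: "z = poly (map_poly of_rat r) \<alpha>"
    using assms(3) by (auto simp: rat_adjoin_def)
  have "\<not> p dvd r"
  proof
    assume "p dvd r"
    then obtain k where "r = p * k" ..
    then show False using assms(2,4) r by (simp add: poly_of_rat_mult)
  qed
  then have "coprime p r"
    by (rule prime_elem_imp_coprime[OF irreducible_imp_prime_elem[OF assms(1)]])
  then obtain y k where "y * p + k * r = 1"
    using bezout_coefficients_fst_snd[of p r] by (metis coprime_imp_gcd_eq_1)
  then have "poly (map_poly of_rat (y * p + k * r)) \<alpha> = 1"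
    by simp
  then have "z * poly (map_poly of_rat k) \<alpha> = 1"
    by (simp add: poly_of_rat_add poly_of_rat_mult assms(2) r mult.commute)
  then show ?thesis by (auto simp: rat_adjoin_def)
qed

lemma word_weight_rat_adjoin:
  fixes lam :: "real ^ 'a"
  assumes "\<And>a. lam $ a \<in> rat_adjoin \<alpha>"
  shows "word_weight lam w \<in> rat_adjoin \<alpha>"
  by (induction w) (use assms in \<open>auto intro: rat_adjoin_add rat_adjoin_0\<close>)

lemma field_hom_word_weight:
  fixes lam :: "real ^ 'a"
  assumes hom: "field_hom_on (rat_adjoin \<alpha>) L \<eta>"
    and lam: "\<And>a. lam $ a \<in> rat_adjoin \<alpha>"
  shows "\<eta> (word_weight lam w) = word_weight (\<chi> a. \<eta> (lam $ a)) w"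
proof (induction w)
  case Nil
  have "\<eta> (0 + 0) = \<eta> 0 + \<eta> 0"
    using hom rat_adjoin_0 unfolding field_hom_on_def by blast
  then show ?case by simp
next
  case (Cons a w)
  have "\<eta> (lam $ a + word_weight lam w) = \<eta> (lam $ a) + \<eta> (word_weight lam w)"
    using hom lam word_weight_rat_adjoin[OF lam] unfolding field_hom_on_def by blast
  then show ?case by (simp add: Cons.IH)
qed

text \<open>A unital homomorphism cannot annihilate an invertible element, and \<open>y - z\<close> would be one.\<close>

lemma field_hom_inj:
  assumes hom: "field_hom_on (rat_adjoin \<alpha>) L \<eta>"
    and p: "irreducible (p :: rat poly)" "poly (map_poly of_rat p) \<alpha> = 0"
    and yz: "y \<in> rat_adjoin \<alpha>" "z \<in> rat_adjoin \<alpha>" "\<eta> y = \<eta> z"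
  shows "y = z"
proof (rule ccontr)
  assume "y \<noteq> z"
  have diff: "y - z \<in> rat_adjoin \<alpha>" using yz by (intro rat_adjoin_diff)
  have "\<eta> ((y - z) + z) = \<eta> (y - z) + \<eta> z"
    using hom diff yz unfolding field_hom_on_def by blast
  then have 0: "\<eta> (y - z) = 0" using yz(3) by simp
  obtain z' where z': "z' \<in> rat_adjoin \<alpha>" "(y - z) * z' = 1"
    using rat_adjoin_inverse[OF p diff] \<open>y \<noteq> z\<close> by auto
  have "\<eta> ((y - z) * z') = \<eta> (y - z) * \<eta> z'" "\<eta> 1 = 1"
    using hom diff z' unfolding field_hom_on_def by blast+
  then show False using 0 z'(2) by simp
qed

lemma eigenvector_subst_matrix_weight:
  assumes "eigenvector (subst_matrix \<sigma>) lam \<theta>"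
  shows "word_weight lam (\<sigma> a) = \<theta> * lam $ a"
proof -
  have count: "word_weight lam w = (\<Sum>b\<in>UNIV. real (count_list w b) * lam $ b)" for w
  proof (induction w)
    case (Cons c w)
    have "real (count_list (c # w) b) * lam $ b
        = (if b = c then lam $ b else 0) + real (count_list w b) * lam $ b" for b
      by (simp add: algebra_simps)
    then show ?case by (simp add: Cons.IH sum.distrib)
  qed simp
  have "(subst_matrix \<sigma> *v lam) $ a = \<theta> * lam $ a"
    using assms by (simp add: eigenvector_def)
  then show ?thesis
    unfolding count by (simp add: matrix_vector_mult_def subst_matrix_def)
qed

theorem lemma17:
  fixes \<sigma> :: "'a::finite \<Rightarrow> 'a list"
    and M :: "real ^ 'a ^ 'a"
    and \<theta>\<^sub>1 \<theta>\<^sub>2 :: real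
    and lam \<gamma> :: "real ^ 'a"
    and \<eta> :: "real \<Rightarrow> real"
    and x :: "int \<Rightarrow> 'a"
  assumes "substitution \<sigma>" and "subst_primitive \<sigma>"
    and "M = subst_matrix \<sigma>"
    and "\<forall>a b. 0 < M $ a $ b"
    and "perron_frobenius_eigenvalue M \<theta>\<^sub>1"
    and "eigenvalue M \<theta>\<^sub>2"
    and "galois_conjugate \<theta>\<^sub>1 \<theta>\<^sub>2"
    and "1 < \<theta>\<^sub>2" and "\<theta>\<^sub>2 < \<theta>\<^sub>1"
    and "eigenvector M lam \<theta>\<^sub>1"
    and "\<forall>a. 0 < lam $ a"
    and "\<forall>a. lam $ a \<in> rat_adjoin \<theta>\<^sub>1"
    and "field_hom_on (rat_adjoin \<theta>\<^sub>1) (rat_adjoin \<theta>\<^sub>2) \<eta>"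
    and "\<eta> \<theta>\<^sub>1 = \<theta>\<^sub>2"
    and "\<gamma> = (\<chi> a. \<eta> (lam $ a))"
    and "minimal_point \<sigma> \<gamma> x"
  shows "liminf (\<lambda>n. ereal (word_weight \<gamma> (map x [0..int n])
             / real n powr (ln \<theta>\<^sub>2 / ln \<theta>\<^sub>1))) > 0
       \<and> liminf (\<lambda>n. ereal (- word_weight \<gamma> (map x [- int n..-1])
             / real n powr (ln \<theta>\<^sub>2 / ln \<theta>\<^sub>1))) > 0"
proof -
  have hom: "field_hom_on (rat_adjoin \<theta>\<^sub>1) (rat_adjoin \<theta>\<^sub>2) \<eta>" by fact
  have lamK: "lam $ a \<in> rat_adjoin \<theta>\<^sub>1" for a using assms(12) ..
  have lam: "word_weight lam (\<sigma> a) = \<theta>\<^sub>1 * lam $ a" for a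
    using assms(3,10) by (intro eigenvector_subst_matrix_weight) simp
  have \<eta>: "\<eta> (word_weight lam w) = word_weight \<gamma> w" for w
    unfolding \<open>\<gamma> = _\<close> by (rule field_hom_word_weight[OF hom lamK])
  obtain p :: "rat poly" where p: "irreducible p" "poly (map_poly of_rat p) \<theta>\<^sub>1 = 0"
    using \<open>galois_conjugate \<theta>\<^sub>1 \<theta>\<^sub>2\<close> by (auto simp: galois_conjugate_def)
  interpret conjugate_weights \<sigma> \<gamma> \<theta>\<^sub>2 lam \<theta>\<^sub>1
  proof
    show "word_weight \<gamma> (\<sigma> a) = \<theta>\<^sub>2 * \<gamma> $ a" for a
    proof -
      have "\<eta> (\<theta>\<^sub>1 * lam $ a) = \<eta> \<theta>\<^sub>1 * \<eta> (lam $ a)"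
        using hom lamK rat_adjoin_self unfolding field_hom_on_def by blast
      then show ?thesis
        using \<eta>[of "\<sigma> a"] unfolding lam by (simp add: \<open>\<eta> \<theta>\<^sub>1 = \<theta>\<^sub>2\<close> \<open>\<gamma> = _\<close>)
    qed
    show "word_weight lam U = word_weight lam V" if "word_weight \<gamma> U = word_weight \<gamma> V" for U V
      by (rule field_hom_inj[OF hom p]) (use that in \<open>simp_all add: \<eta> word_weight_rat_adjoin[OF lamK]\<close>)
  qed (use assms lam in auto)
  define \<alpha> where "\<alpha> = ln \<theta>\<^sub>2 / ln \<theta>\<^sub>1"
  have "0 < \<alpha>" using expanding theta1_gt_1 by (simp add: \<alpha>_def)
  obtain \<kappa> n0 where \<kappa>: "0 < \<kappa>"
    "\<And>n. n0 \<le> n \<Longrightarrow> \<kappa> * real n powr \<alpha> \<le> partial_weight \<gamma> x (int n)"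
    "\<And>n. n0 \<le> n \<Longrightarrow> \<kappa> * real n powr \<alpha> \<le> partial_weight \<gamma> x (- int n)"
    unfolding \<alpha>_def using minimal_point_growth[OF \<open>minimal_point \<sigma> \<gamma> x\<close>] by blast
  have liminf: "0 < liminf (\<lambda>n. ereal (h n / real n powr \<alpha>))"
    if "\<And>n. Suc n0 \<le> n \<Longrightarrow> \<kappa> * real n powr \<alpha> \<le> h n" for h
  proof -
    have "\<kappa> \<le> h n / real n powr \<alpha>" if "Suc n0 \<le> n" for n
      using \<open>Suc n0 \<le> n \<Longrightarrow> _\<close>[OF that] that by (simp add: pos_le_divide_eq)
    then have "ereal \<kappa> \<le> liminf (\<lambda>n. ereal (h n / real n powr \<alpha>))"
      by (intro Liminf_bounded) (auto simp: eventually_sequentially)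
    then show ?thesis using \<kappa>(1) by (metis ereal_less(2) less_le_trans)
  qed
  \<comment> \<open>The word \<open>x\<^sub>0 \<dots> x\<^sub>n\<close> has \<open>n + 1\<close> letters, so its weight is the partial weight at \<open>Suc n\<close>.\<close>
  have "\<kappa> * real n powr \<alpha> \<le> word_weight \<gamma> (map x [0..int n])" if "Suc n0 \<le> n" for n
  proof -
    have "\<kappa> * real n powr \<alpha> \<le> \<kappa> * real (Suc n) powr \<alpha>"
      using \<kappa>(1) \<open>0 < \<alpha>\<close> by (intro mult_left_mono powr_mono2) auto
    also have "\<dots> \<le> partial_weight \<gamma> x (int (Suc n))" using \<kappa>(2)[of "Suc n"] that by simp
    also have "{0..<int (Suc n)} = {0..int n}" by auto
    then have "partial_weight \<gamma> x (int (Suc n)) = word_weight \<gamma> (map x [0..int n])"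
      unfolding word_weight_map_upto partial_weight_def by simp
    finally show ?thesis .
  qed
  moreover have "\<kappa> * real n powr \<alpha> \<le> - word_weight \<gamma> (map x [- int n..-1])" if "Suc n0 \<le> n" for n
    using \<kappa>(3)[of n] that unfolding word_weight_map_upto partial_weight_def by simp
  ultimately show ?thesis
    unfolding \<alpha>_def[symmetric] by (intro conjI liminf)
qed

end
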